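(* Suppose the basic assumptions (1)–(5) hold in the template matching model $Y_i = f(X_i-\theta^* )+Z_i$, $i=1,\dots,n$. Then the M-estimator $\hat\theta_n$ is consistent for $\theta^*$, i.e., $\hat\theta_n \to \theta^*$ in probability as $n\to\infty$.
   Context: Model. We observe $(X_1,Y_1),\dots,(X_n,Y_n)$ with $Y_i = f(X_i-\theta^* )+Z_i$, where $f:\mathbb{R}\to\mathbb{R}$ is a known function (the template) and $\theta^*\in\mathbb{R}$ is the unknown shift. The design points $X_i$ are iid with density $\lambda$; the noise variables $Z_i$ are iid with density $\phi$ and independent of the design points. $(X,Y)$ and $Z$ denote a generic observation and noise variable; $\mathbb{E}$ is expectation under the true shift $\theta^*$. M-estimator. Given a loss function $L:\mathbb{R}\to\mathbb{R}$, let $m_\theta(x,y) := L(y-f(x-\theta))$, $\widehat M_n(\theta) := \frac1n\sum_{i=1}^n m_\theta(X_i,Y_i)$, $M(\theta) := \mathbb{E}[m_\theta(X,Y)]$, and let $\hat\theta_n$ be a minimizer of $\widehat M_n$ over $\theta$. If $A$ is such that $f$ and $\lambda$ are both supported on $[-A,A]$, the model is $Y_i=Z_i$ for every $\theta$ outside $[-2A,2A]$, so the parameter is effectively restricted to the compact interval $[-2A,2A]$. Basic assumptions. (1) $f$ is compactly supported and càdlàg with none or finitely many discontinuities (in particular bounded); and for any $\theta\neq\theta^*$, $\int (f(x-\theta^* )-f(x-\theta))^2\lambda(x)\,dx>0$. (2) $\lambda$ is compactly supported. (3) $\phi$ is even. (4) $L$ is non-negative, even, non-decreasing away from the origin (i.e.,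 on $[0,\infty)$), non-constant, and either Lipschitz or has a Lipschitz derivative. (5) $M$ is well-defined (finite); $\theta^*$ is the unique minimizer of $M$; and $\inf\{M(\theta):|\theta-\theta^*|\ge\delta\}>M(\theta^* )$ for every $\delta>0$. *)

theory Defs
  imports "HOL-Probability.Probability"
begin

definition compactly_supported :: "(real \<Rightarrow> real) \<Rightarrow> bool" where
  "compactly_supported f \<longleftrightarrow> compact (closure {x. f x \<noteq> 0})"

definition cadlag :: "(real \<Rightarrow> real) \<Rightarrow> bool" where
  "cadlag f \<longleftrightarrow> (\<forall>x. continuous (at_right x) f \<and> (\<exists>l. (f \<longlongrightarrow> l) (at_left x)))"

definition has_density :: "'a measure \<Rightarrow> ('a \<Rightarrow> real) \<Rightarrow> (real \<Rightarrow> real) \<Rightarrow> bool" where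
  "has_density P X d \<longleftrightarrow> (\<forall>x. 0 \<le> d x) \<and> distributed P lborel X (\<lambda>x. ennreal (d x))"

definition response ::
    "(real \<Rightarrow> real) \<Rightarrow> real \<Rightarrow> (nat \<Rightarrow> 'a \<Rightarrow> real) \<Rightarrow> (nat \<Rightarrow> 'a \<Rightarrow> real) \<Rightarrow> nat \<Rightarrow> 'a \<Rightarrow> real" where
  "response f \<theta> X Z i \<omega> = f (X i \<omega> - \<theta>) + Z i \<omega>"

definition contrast :: "(real \<Rightarrow> real) \<Rightarrow> (real \<Rightarrow> real) \<Rightarrow> real \<Rightarrow> real \<Rightarrow> real \<Rightarrow> real" where
  "contrast L f \<theta> x y = L (y - f (x - \<theta>))"

text \<open>The observations are numbered from 0, so a sample of size \<open>n\<close> is indexed by \<open>{..<n}\<close>.\<close>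

definition empirical_risk ::
    "(real \<Rightarrow> real) \<Rightarrow> (real \<Rightarrow> real) \<Rightarrow> (nat \<Rightarrow> 'a \<Rightarrow> real) \<Rightarrow> (nat \<Rightarrow> 'a \<Rightarrow> real)
      \<Rightarrow> nat \<Rightarrow> 'a \<Rightarrow> real \<Rightarrow> real" where
  "empirical_risk L f X Y n \<omega> \<theta> = (1 / real n) * (\<Sum>i<n. contrast L f \<theta> (X i \<omega>) (Y i \<omega>))"

text \<open>The Bochner integral is 0 for a non-integrable integrand, so finiteness of the risk
  has to be required separately, as integrability of the contrast.\<close>

definition population_risk ::
    "'a measure \<Rightarrow> (real \<Rightarrow> real) \<Rightarrow> (real \<Rightarrow> real) \<Rightarrow> ('a \<Rightarrow> real) \<Rightarrow> ('a \<Rightarrow> real) \<Rightarrow> real \<Rightarrow> real" where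
  "population_risk P L f X Y \<theta> = (\<integral>\<omega>. contrast L f \<theta> (X \<omega>) (Y \<omega>) \<partial>P)"

text \<open>Joint independence of all the \<open>X i\<close> and \<open>Z i\<close> is expressed by indexing the combined family
  by the disjoint sum of two copies of the naturals. In the identifiability condition, the integrand
  is non-negative, and a positive Bochner integral entails that it is integrable.
  The generic observation in the population risk is observation number 0, all observations being
  identically distributed.\<close>

locale template_matching = prob_space P
  for P :: "'a measure" +
  fixes f lam \<phi> L :: "real \<Rightarrow> real"
    and \<theta>s :: real
    and X Z :: "nat \<Rightarrow> 'a \<Rightarrow> real"
  assumes design_density: "\<And>i. has_density P (X i) lam"
    and noise_density: "\<And>i. has_density P (Z i) \<phi>"
    and independent: "indep_vars (\<lambda>_. borel) (case_sum X Z) (UNIV :: (nat + nat) set)"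
    and template_support: "compactly_supported f"
    and template_cadlag: "cadlag f"
    and template_discont: "finite {x. \<not> isCont f x}"
    and identifiable:
      "\<And>\<theta>. \<theta> \<noteq> \<theta>s \<Longrightarrow> 0 < (\<integral>x. (f (x - \<theta>s) - f (x - \<theta>))\<^sup>2 * lam x \<partial>lborel)"
    and design_support: "compactly_supported lam"
    and noise_even: "\<And>z. \<phi> (- z) = \<phi> z"
    and loss_nonneg: "\<And>u. 0 \<le> L u"
    and loss_even: "\<And>u. L (- u) = L u"
    and loss_mono: "mono_on {0..} L"
    and loss_nonconst: "\<not> L constant_on UNIV"
    and loss_lipschitz:
      "(\<exists>C. lipschitz_on C UNIV L) \<or>
       (\<exists>L' C. (\<forall>u. (L has_real_derivative L' u) (at u)) \<and> lipschitz_on C UNIV L')"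
    and risk_finite:
      "\<And>\<theta>. integrable P (\<lambda>\<omega>. contrast L f \<theta> (X 0 \<omega>) (response f \<theta>s X Z 0 \<omega>))"
    and risk_unique_min:
      "\<And>\<theta>. is_arg_min (population_risk P L f (X 0) (response f \<theta>s X Z 0)) (\<lambda>_. True) \<theta>
         \<longleftrightarrow> \<theta> = \<theta>s"
    and risk_separated:
      "\<And>\<delta>. 0 < \<delta> \<Longrightarrow>
         population_risk P L f (X 0) (response f \<theta>s X Z 0) \<theta>s
           < (INF \<theta>\<in>{\<theta>. \<delta> \<le> \<bar>\<theta> - \<theta>s\<bar>}. population_risk P L f (X 0) (response f \<theta>s X Z 0) \<theta>)"

definition converges_in_prob :: "'a measure \<Rightarrow> (nat \<Rightarrow> 'a \<Rightarrow> real) \<Rightarrow> real \<Rightarrow> bool" where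
  "converges_in_prob P T c \<longleftrightarrow>
     (\<forall>\<epsilon>>0. (\<lambda>n. measure P {\<omega> \<in> space P. \<epsilon> < \<bar>T n \<omega> - c\<bar>}) \<longlonglongrightarrow> 0)"

end

theory Submission
  imports Defs
begin

text \<open>
  The proof is Wald's argument for minimum contrast estimators: lower bounds on the loss, uniform
  over small sets of parameters, together with the law of large numbers for finitely many such
  bounds. Write \<open>loss \<theta>\<close> for the contrast at \<open>\<theta>\<close> as a function of the design point and the noise.

  Since \<open>L\<close> is continuous and \<open>f\<close> has finitely many discontinuities, for each fixed \<open>\<theta>\<close> and almost
  every observation the loss is a continuous function of the parameter at \<open>\<theta>\<close>. The infimum of the
  loss over a ball around \<open>\<theta>\<close> therefore converges to \<open>loss \<theta>\<close> as the radius shrinks. It lies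
  between \<open>0\<close> and the integrable \<open>loss \<theta>\<close>, so by dominated convergence its expectation converges
  to the risk at \<open>\<theta>\<close> (\<open>local_risk_tendsto\<close>). Wherever the risk exceeds that of \<open>\<theta>s\<close>, so does
  the expected infimum over some small ball. The infimum over the uncountable ball is
  kept measurable by restricting it to rational parameters, which changes nothing: right-continuity
  of \<open>f\<close> makes the loss left-continuous in \<open>\<theta>\<close>.

  Parameters at distance at least \<open>\<delta>\<close> from \<open>\<theta>s\<close> are handled in two parts. In a large compact interval,
  finitely many of these balls cover them. Outside it, the shifted template and the design do not
  overlap, so the loss almost surely no longer depends on the parameter and a single parameter represents all of
  them. This yields finitely many functions, each with expectation larger than the risk at \<open>\<theta>s\<close>, such
  that every loss at distance at least \<open>\<delta>\<close> dominates one of them on all observations at once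
  (\<open>finite_lower_bracket\<close>).

  If a minimizer of the empirical risk is at distance more than \<open>\<delta>\<close> from \<open>\<theta>s\<close>, then one of these functions has
  an empirical mean no larger than that of \<open>loss \<theta>s\<close>, although its expectation is strictly larger. The
  weak law of large numbers makes this event improbable for large samples. The losses are only
  known to have a first moment, so the weak law is proved for integrable variables, by truncation.
\<close>

section \<open>A weak law of large numbers\<close>

definition clamp_real :: "real \<Rightarrow> real \<Rightarrow> real" where
  "clamp_real K x = max (- K) (min K x)"

lemma clamp_real_measurable [measurable]: "clamp_real K \<in> borel_measurable borel"
  unfolding clamp_real_def by measurable

lemma clamp_real_bounds:
  assumes "0 \<le> K"
  shows "clamp_real K x \<in> {- K..K}" "\<bar>x - clamp_real K x\<bar> \<le> \<bar>x\<bar>"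
  using assms by (auto simp: clamp_real_def max_def min_def)

lemma (in prob_space) truncation_error_small:
  assumes int: "integrable M V" and "0 < d"
  shows "\<exists>K>0. expectation (\<lambda>\<omega>. \<bar>V \<omega> - clamp_real K (V \<omega>)\<bar>) < d"
proof -
  have [measurable]: "V \<in> borel_measurable M" using int by simp
  have "(\<lambda>k. expectation (\<lambda>\<omega>. \<bar>V \<omega> - clamp_real (real k) (V \<omega>)\<bar>)) \<longlonglongrightarrow> expectation (\<lambda>_. 0)"
  proof (rule integral_dominated_convergence[where w = "\<lambda>\<omega>. \<bar>V \<omega>\<bar>"])
    show "AE \<omega> in M. (\<lambda>k. \<bar>V \<omega> - clamp_real (real k) (V \<omega>)\<bar>) \<longlonglongrightarrow> 0"
    proof (rule AE_I2)
      fix \<omega>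
      obtain N :: nat where "\<bar>V \<omega>\<bar> \<le> real N" using real_arch_simple by blast
      then have "\<bar>V \<omega> - clamp_real (real k) (V \<omega>)\<bar> = 0" if "N \<le> k" for k
        using that by (auto simp: clamp_real_def max_def min_def)
      then show "(\<lambda>k. \<bar>V \<omega> - clamp_real (real k) (V \<omega>)\<bar>) \<longlonglongrightarrow> 0"
        by (intro tendsto_eventually eventually_sequentiallyI)
    qed
  qed (use int in \<open>auto simp: clamp_real_bounds\<close>)
  then have "eventually (\<lambda>k. expectation (\<lambda>\<omega>. \<bar>V \<omega> - clamp_real (real k) (V \<omega>)\<bar>) < d) sequentially"
    using \<open>0 < d\<close> by (intro order_tendstoD(2)) auto
  then have "eventually (\<lambda>k. expectation (\<lambda>\<omega>. \<bar>V \<omega> - clamp_real (real k) (V \<omega>)\<bar>) < d \<and> 0 < k) sequentially"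
    using eventually_gt_at_top by (rule eventually_conj)
  then obtain k where "expectation (\<lambda>\<omega>. \<bar>V \<omega> - clamp_real (real k) (V \<omega>)\<bar>) < d" "0 < k"
    by (metis (no_types, lifting) eventually_at_top_linorder order_refl)
  then show ?thesis by (intro exI[of _ "real k"]) simp
qed

lemma integral_eq_if_distr_eq:
  fixes h :: "'b \<Rightarrow> real"
  assumes "V \<in> measurable M N" "W \<in> measurable M N" "distr M N V = distr M N W"
    and "h \<in> borel_measurable N"
  shows "(\<integral>\<omega>. h (V \<omega>) \<partial>M) = (\<integral>\<omega>. h (W \<omega>) \<partial>M)"
  using assms by (metis integral_distr)

lemma integrable_if_distr_eq:
  fixes h :: "'b \<Rightarrow> real"
  assumes "V \<in> measurable M N" "W \<in> measurable M N" "distr M N V = distr M N W"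
    and "h \<in> borel_measurable N" "integrable M (\<lambda>\<omega>. h (W \<omega>))"
  shows "integrable M (\<lambda>\<omega>. h (V \<omega>))"
  using assms by (metis integrable_distr_eq)

text \<open>
  Truncate every variable at a level \<open>K\<close> that makes the first moment of the truncation error
  small. This error shifts the expectation by less than \<open>\<epsilon> / 3\<close>, and by Markov's inequality its
  sample mean exceeds \<open>\<epsilon> / 3\<close> with small probability, uniformly in the sample size. What remains
  is a mean of bounded variables, for which Hoeffding's inequality gives exponential decay.
\<close>

theorem (in prob_space) weak_law_of_large_numbers:
  fixes V :: "nat \<Rightarrow> 'a \<Rightarrow> real"
  assumes indep: "indep_vars (\<lambda>_. borel) V UNIV"
    and ident: "\<And>i. distr M borel (V i) = distr M borel (V 0)"
    and int: "integrable M (V 0)"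
    and "0 < \<epsilon>"
  shows "(\<lambda>n. prob {\<omega> \<in> space M. \<epsilon> \<le> \<bar>(\<Sum>i<n. V i \<omega>) / real n - expectation (V 0)\<bar>}) \<longlonglongrightarrow> 0"
proof (rule LIMSEQ_I)
  fix e :: real
  assume "0 < e"
  have V [measurable]: "V i \<in> borel_measurable M" for i
    using indep by (auto simp: indep_vars_def)
  define \<mu> where "\<mu> = expectation (V 0)"
  \<comment> \<open>The bound \<open>\<epsilon> / 3\<close> controls the shift of the expectation; the bound \<open>e * \<epsilon> / 6\<close> is what
    Markov's inequality at level \<open>\<epsilon> / 3\<close> turns into \<open>e / 2\<close>.\<close>
  obtain K where "0 < K"
    and K: "expectation (\<lambda>\<omega>. \<bar>V 0 \<omega> - clamp_real K (V 0 \<omega>)\<bar>) < min (\<epsilon> / 3) (e * \<epsilon> / 6)"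
    using truncation_error_small[OF int, of "min (\<epsilon> / 3) (e * \<epsilon> / 6)"] \<open>0 < e\<close> \<open>0 < \<epsilon>\<close> by auto
  define U where "U i \<omega> = clamp_real K (V i \<omega>)" for i \<omega>
  define R where "R i \<omega> = \<bar>V i \<omega> - U i \<omega>\<bar>" for i \<omega>
  define \<nu> where "\<nu> = expectation (U 0)"
  have [measurable]: "U i \<in> borel_measurable M" "R i \<in> borel_measurable M" for i
    unfolding U_def R_def by measurable
  have R_le: "R i \<omega> \<le> \<bar>V i \<omega>\<bar>" for i \<omega>
    unfolding R_def U_def using clamp_real_bounds(2) \<open>0 < K\<close> by simp
  have intU: "integrable M (U 0)"
    by (rule integrable_const_bound[where B = K])
       (use clamp_real_bounds(1)[of K] \<open>0 < K\<close> in \<open>auto simp: U_def abs_le_iff minus_le_iff\<close>)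
  have intR0: "integrable M (R 0)"
    by (rule Bochner_Integration.integrable_bound[OF int]) (use R_le in \<open>auto simp: R_def\<close>)
  have intR: "integrable M (R i)" for i
    using integrable_if_distr_eq[OF V V ident, of "\<lambda>x. \<bar>x - clamp_real K x\<bar>" i] intR0
    by (simp add: R_def[abs_def] U_def[abs_def])
  have expR: "expectation (R i) = expectation (R 0)" for i
    using integral_eq_if_distr_eq[OF V V ident, of "\<lambda>x. \<bar>x - clamp_real K x\<bar>" i]
    by (simp add: R_def[abs_def] U_def[abs_def])
  have ER: "expectation (R 0) < \<epsilon> / 3" "expectation (R 0) < e * \<epsilon> / 6"
    using K by (simp_all add: R_def[abs_def] U_def[abs_def])
  have "\<bar>\<mu> - \<nu>\<bar> = \<bar>expectation (\<lambda>\<omega>. V 0 \<omega> - U 0 \<omega>)\<bar>"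
    unfolding \<mu>_def \<nu>_def using int intU by simp
  also have "\<dots> \<le> expectation (R 0)"
    unfolding R_def by (rule integral_abs_bound)
  finally have bias: "\<bar>\<mu> - \<nu>\<bar> < \<epsilon> / 3" using ER by simp
  have tail: "prob {\<omega> \<in> space M. \<epsilon> / 3 \<le> (\<Sum>i<n. R i \<omega>) / real n} \<le> e / 2" if "0 < n" for n :: nat
  proof -
    have "prob {\<omega> \<in> space M. \<epsilon> / 3 \<le> (\<Sum>i<n. R i \<omega>) / real n}
        \<le> expectation (\<lambda>\<omega>. (\<Sum>i<n. R i \<omega>) / real n) / (\<epsilon> / 3)"
    proof (rule integral_Markov_inequality_measure[where A = "{}"])
      show "integrable M (\<lambda>\<omega>. (\<Sum>i<n. R i \<omega>) / real n)"
        using intR by auto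
    qed (use \<open>0 < \<epsilon>\<close> in \<open>auto intro!: divide_nonneg_nonneg sum_nonneg simp: R_def\<close>)
    also have "expectation (\<lambda>\<omega>. (\<Sum>i<n. R i \<omega>) / real n) = expectation (R 0)"
    proof -
      have "(\<Sum>i<n. expectation (R i)) = (\<Sum>i<n. expectation (R 0))"
        by (rule sum.cong[OF refl expR])
      then show ?thesis using that intR by (simp add: Bochner_Integration.integral_sum)
    qed
    also have "expectation (R 0) / (\<epsilon> / 3) \<le> e / 2"
      using ER \<open>0 < \<epsilon>\<close> by (simp add: field_simps)
    finally show ?thesis .
  qed
  have bulk: "prob {\<omega> \<in> space M. \<epsilon> / 3 \<le> \<bar>(\<Sum>i<n. U i \<omega>) / real n - \<nu>\<bar>}
      \<le> 2 * exp (- 2 * real n * (\<epsilon> / 3)\<^sup>2 / (K - - K)\<^sup>2)" if "0 < n" for n :: nat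
  proof -
    interpret H: Hoeffding_ineq_iid M "{..<n}" U "U 0" "- K" K \<nu>
    proof unfold_locales
      show "indep_vars (\<lambda>_. borel) U {..<n}"
        unfolding U_def
        by (rule indep_vars_compose2[OF indep_vars_subset[OF indep]]) auto
      show "distr M borel (U i) = distr M borel (U 0)" for i
      proof -
        have eq: "distr M borel (U j) = distr (distr M borel (V j)) borel (clamp_real K)" for j
          by (simp add: distr_distr U_def[abs_def] comp_def)
        show ?thesis by (simp only: eq ident[of i])
      qed
      show "AE x in M. U 0 x \<in> {- K..K}"
        using clamp_real_bounds(1)[of K] \<open>0 < K\<close> by (simp add: U_def)
    qed (simp_all add: \<nu>_def)
    show ?thesis
      using H.Hoeffding_ineq_abs_ge'[of "\<epsilon> / 3"] that \<open>0 < K\<close> \<open>0 < \<epsilon>\<close> by auto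
  qed
  have "(\<lambda>n. 2 * exp (- 2 * real n * (\<epsilon> / 3)\<^sup>2 / (K - - K)\<^sup>2)) \<longlonglongrightarrow> 0"
  proof -
    define c where "c = exp (- 2 * (\<epsilon> / 3)\<^sup>2 / (K - - K)\<^sup>2)"
    have "0 < 2 * (\<epsilon> / 3)\<^sup>2 / (K - - K)\<^sup>2" using \<open>0 < K\<close> \<open>0 < \<epsilon>\<close> by simp
    then have "norm c < 1" by (simp add: c_def)
    then have "(\<lambda>n. 2 * c ^ n) \<longlonglongrightarrow> 2 * 0"
      by (intro tendsto_mult_left LIMSEQ_power_zero)
    moreover have "c ^ n = exp (- 2 * real n * (\<epsilon> / 3)\<^sup>2 / (K - - K)\<^sup>2)" for n
      unfolding c_def by (simp flip: exp_of_nat_mult)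
    ultimately show ?thesis by simp
  qed
  then have "eventually (\<lambda>n. 2 * exp (- 2 * real n * (\<epsilon> / 3)\<^sup>2 / (K - - K)\<^sup>2) < e / 2) sequentially"
    by (rule order_tendstoD) (use \<open>0 < e\<close> in simp)
  then obtain N where
    N: "\<And>n. N \<le> n \<Longrightarrow> 2 * exp (- 2 * real n * (\<epsilon> / 3)\<^sup>2 / (K - - K)\<^sup>2) < e / 2"
    by (auto simp: eventually_sequentially)
  show "\<exists>N. \<forall>n\<ge>N. norm (prob {\<omega> \<in> space M.
      \<epsilon> \<le> \<bar>(\<Sum>i<n. V i \<omega>) / real n - expectation (V 0)\<bar>} - 0) < e"
  proof (intro exI[of _ "max N 1"] allI impI)
    fix n
    assume "max N 1 \<le> n"
    then have "0 < n" "N \<le> n" by auto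
    let ?A = "{\<omega> \<in> space M. \<epsilon> / 3 \<le> (\<Sum>i<n. R i \<omega>) / real n}"
    let ?B = "{\<omega> \<in> space M. \<epsilon> / 3 \<le> \<bar>(\<Sum>i<n. U i \<omega>) / real n - \<nu>\<bar>}"
    have "{\<omega> \<in> space M. \<epsilon> \<le> \<bar>(\<Sum>i<n. V i \<omega>) / real n - \<mu>\<bar>} \<subseteq> ?A \<union> ?B"
    proof -
      have gap: "\<bar>(\<Sum>i<n. V i \<omega>) / real n - (\<Sum>i<n. U i \<omega>) / real n\<bar> \<le> (\<Sum>i<n. R i \<omega>) / real n" for \<omega>
      proof -
        have "\<bar>\<Sum>i<n. V i \<omega> - U i \<omega>\<bar> \<le> (\<Sum>i<n. R i \<omega>)"
          unfolding R_def by (rule sum_abs)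
        then have "\<bar>\<Sum>i<n. V i \<omega> - U i \<omega>\<bar> / real n \<le> (\<Sum>i<n. R i \<omega>) / real n"
          by (rule divide_right_mono) simp
        then show ?thesis
          by (simp add: sum_subtractf diff_divide_distrib[symmetric])
      qed
      show ?thesis
      proof
        fix \<omega>
        assume "\<omega> \<in> {\<omega> \<in> space M. \<epsilon> \<le> \<bar>(\<Sum>i<n. V i \<omega>) / real n - \<mu>\<bar>}"
        then have "\<omega> \<in> space M" "\<epsilon> \<le> \<bar>(\<Sum>i<n. V i \<omega>) / real n - \<mu>\<bar>" by auto
        moreover from this have "\<epsilon> / 3 \<le> (\<Sum>i<n. R i \<omega>) / real n
            \<or> \<epsilon> / 3 \<le> \<bar>(\<Sum>i<n. U i \<omega>) / real n - \<nu>\<bar>"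
          using gap[of \<omega>] bias by linarith
        ultimately show "\<omega> \<in> ?A \<union> ?B" by auto
      qed
    qed
    then have "prob {\<omega> \<in> space M. \<epsilon> \<le> \<bar>(\<Sum>i<n. V i \<omega>) / real n - \<mu>\<bar>} \<le> prob (?A \<union> ?B)"
      by (intro finite_measure_mono) auto
    also have "\<dots> \<le> prob ?A + prob ?B"
      by (rule measure_Un_le) auto
    also have "\<dots> < e"
      using tail[OF \<open>0 < n\<close>] bulk[OF \<open>0 < n\<close>] N[OF \<open>N \<le> n\<close>] by linarith
    finally show "norm (prob {\<omega> \<in> space M.
        \<epsilon> \<le> \<bar>(\<Sum>i<n. V i \<omega>) / real n - expectation (V 0)\<bar>} - 0) < e"
      by (simp add: \<mu>_def)
  qed
qed

text \<open>
  The form in which two contrasts are compared: applied to their difference, it says that the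
  empirical means are ordered like the expectations with probability tending to one.
\<close>

corollary (in prob_space) prob_sum_nonpos_tendsto_0:
  fixes V :: "nat \<Rightarrow> 'a \<Rightarrow> real"
  assumes indep: "indep_vars (\<lambda>_. borel) V UNIV"
    and ident: "\<And>i. distr M borel (V i) = distr M borel (V 0)"
    and int: "integrable M (V 0)"
    and pos: "0 < expectation (V 0)"
  shows "(\<lambda>n. prob {\<omega> \<in> space M. (\<Sum>i<n. V i \<omega>) \<le> 0}) \<longlonglongrightarrow> 0"
proof (rule tendsto_sandwich[OF _ _ tendsto_const weak_law_of_large_numbers[OF assms]])
  have [measurable]: "V i \<in> borel_measurable M" for i
    using indep by (auto simp: indep_vars_def)
  have "{\<omega> \<in> space M. (\<Sum>i<n. V i \<omega>) \<le> 0}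
      \<subseteq> {\<omega> \<in> space M. expectation (V 0) \<le> \<bar>(\<Sum>i<n. V i \<omega>) / real n - expectation (V 0)\<bar>}" for n
  proof (clarsimp)
    fix \<omega>
    assume "(\<Sum>i<n. V i \<omega>) \<le> 0"
    then have "(\<Sum>i<n. V i \<omega>) / real n \<le> 0" by (simp add: divide_le_0_iff)
    then show "expectation (V 0) \<le> \<bar>(\<Sum>i<n. V i \<omega>) / real n - expectation (V 0)\<bar>"
      by linarith
  qed
  then have "prob {\<omega> \<in> space M. (\<Sum>i<n. V i \<omega>) \<le> 0}
      \<le> prob {\<omega> \<in> space M. expectation (V 0) \<le> \<bar>(\<Sum>i<n. V i \<omega>) / real n - expectation (V 0)\<bar>}" for n
    by (intro finite_measure_mono) auto
  then show "eventually (\<lambda>n. prob {\<omega> \<in> space M. (\<Sum>i<n. V i \<omega>) \<le> 0}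
      \<le> prob {\<omega> \<in> space M. expectation (V 0) \<le> \<bar>(\<Sum>i<n. V i \<omega>) / real n - expectation (V 0)\<bar>}) sequentially"
    by simp
qed simp

section \<open>Independent pairs\<close>

text \<open>
  Independence of the combined family, indexed by a disjoint sum, gives two things: the pairs live on disjoint
  blocks of indices, hence are independent of each other; and the two members of one pair are
  independent, hence its law is the product of the two marginals, which are the same for all \<open>i\<close>.
\<close>

lemma (in prob_space) iid_function_of_pairs:
  fixes X Z :: "nat \<Rightarrow> 'a \<Rightarrow> real" and h :: "real \<times> real \<Rightarrow> real"
  assumes indep: "indep_vars (\<lambda>_. borel) (case_sum X Z) (UNIV :: (nat + nat) set)"
    and X: "\<And>i. distr M borel (X i) = distr M borel (X 0)"
    and Z: "\<And>i. distr M borel (Z i) = distr M borel (Z 0)"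
    and h [measurable]: "h \<in> borel_measurable (borel \<Otimes>\<^sub>M borel)"
  shows "indep_vars (\<lambda>_. borel) (\<lambda>i \<omega>. h (X i \<omega>, Z i \<omega>)) UNIV"
    and "distr M borel (\<lambda>\<omega>. h (X i \<omega>, Z i \<omega>)) = distr M borel (\<lambda>\<omega>. h (X 0 \<omega>, Z 0 \<omega>))"
proof -
  have rv: "case_sum X Z s \<in> borel_measurable M" for s
    using indep by (auto simp: indep_vars_def)
  have [measurable]: "X i \<in> borel_measurable M" "Z i \<in> borel_measurable M" for i
    using rv[of "Inl i"] rv[of "Inr i"] by simp_all
  let ?K = "\<lambda>i::nat. {Inl i, Inr i} :: (nat + nat) set"
  have "indep_vars (\<lambda>i. PiM (?K i) (\<lambda>_. borel)) (\<lambda>i \<omega>. restrict (\<lambda>s. case_sum X Z s \<omega>) (?K i)) UNIV"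
    by (rule indep_vars_restrict[OF indep]) (auto simp: disjoint_family_on_def)
  then have "indep_vars (\<lambda>_. borel)
      (\<lambda>i \<omega>. (\<lambda>w. h (w (Inl i), w (Inr i))) (restrict (\<lambda>s. case_sum X Z s \<omega>) (?K i))) UNIV"
    by (rule indep_vars_compose2) measurable
  then show "indep_vars (\<lambda>_. borel) (\<lambda>i \<omega>. h (X i \<omega>, Z i \<omega>)) UNIV" by simp
  have joint: "distr M borel (X i) \<Otimes>\<^sub>M distr M borel (Z i)
      = distr M (borel \<Otimes>\<^sub>M borel) (\<lambda>\<omega>. (X i \<omega>, Z i \<omega>))" for i
  proof -
    have "indep_var (PiM {Inl i} (\<lambda>_. borel)) (\<lambda>\<omega>. restrict (\<lambda>s. case_sum X Z s \<omega>) {Inl i})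
        (PiM {Inr i} (\<lambda>_. borel)) (\<lambda>\<omega>. restrict (\<lambda>s. case_sum X Z s \<omega>) {Inr i})"
      by (rule indep_var_restrict[OF indep]) auto
    then have "indep_var borel ((\<lambda>w. w (Inl i)) \<circ> (\<lambda>\<omega>. restrict (\<lambda>s. case_sum X Z s \<omega>) {Inl i}))
        borel ((\<lambda>w. w (Inr i)) \<circ> (\<lambda>\<omega>. restrict (\<lambda>s. case_sum X Z s \<omega>) {Inr i}))"
      by (rule indep_var_compose) auto
    then have "indep_var borel (X i) borel (Z i)" by (simp add: comp_def)
    then show ?thesis by (simp add: indep_var_distribution_eq)
  qed
  have eq: "distr M borel (\<lambda>\<omega>. h (X i \<omega>, Z i \<omega>))
      = distr (distr M borel (X i) \<Otimes>\<^sub>M distr M borel (Z i)) borel h" for i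
    unfolding joint by (simp add: distr_distr comp_def)
  show "distr M borel (\<lambda>\<omega>. h (X i \<omega>, Z i \<omega>)) = distr M borel (\<lambda>\<omega>. h (X 0 \<omega>, Z 0 \<omega>))"
    by (simp only: eq X[of i] Z[of i])
qed

section \<open>Infima over small balls\<close>

text \<open>
  If \<open>h t\<close> were below the infimum, so would be all values just left of \<open>t\<close>, among them one at a
  rational point. With a cadlag template, left-continuity in the shift is what holds at every
  parameter.
\<close>

lemma INF_rat_le_of_left_continuous:
  fixes h :: "real \<Rightarrow> real"
  assumes left: "(h \<longlongrightarrow> h t) (at_left t)" and "open U" "t \<in> U"
    and bdd: "bdd_below (range h)"
  shows "(INF q\<in>U \<inter> \<rat>. h q) \<le> h t"
proof (rule ccontr)
  assume "\<not> ?thesis"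
  then have "eventually (\<lambda>s. h s < (INF q\<in>U \<inter> \<rat>. h q)) (at_left t)"
    by (intro order_tendstoD(2)[OF left]) simp
  moreover have "eventually (\<lambda>s. s \<in> U) (at_left t)"
    unfolding eventually_at_filter
    by (rule eventually_mono[OF eventually_nhds_in_open[OF assms(2,3)]]) simp
  ultimately have "eventually (\<lambda>s. h s < (INF q\<in>U \<inter> \<rat>. h q) \<and> s \<in> U) (at_left t)"
    by (rule eventually_conj)
  then obtain b where "b < t" and b: "\<And>s. b < s \<Longrightarrow> s < t \<Longrightarrow> h s < (INF q\<in>U \<inter> \<rat>. h q) \<and> s \<in> U"
    unfolding eventually_at_left_field by blast
  obtain q where q: "b < q" "q < t" "q \<in> \<rat>"
    using Rats_dense_in_real[OF \<open>b < t\<close>] by blast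
  have "(INF q\<in>U \<inter> \<rat>. h q) \<le> h q"
    using b q by (intro cINF_lower bdd_below_mono[OF bdd]) auto
  then show False using b q by fastforce
qed

lemma INF_rat_ball_tendsto:
  fixes h :: "real \<Rightarrow> real"
  assumes cont: "isCont h t" and bdd: "bdd_below (range h)"
  shows "(\<lambda>k. INF q\<in>ball t (1 / real (Suc k)) \<inter> \<rat>. h q) \<longlonglongrightarrow> h t"
proof (rule LIMSEQ_I)
  fix e :: real
  assume "0 < e"
  then obtain d where "0 < d" and d: "\<And>s. dist s t < d \<Longrightarrow> dist (h s) (h t) < e / 2"
    using cont unfolding continuous_at_eps_delta by (metis half_gt_zero)
  obtain N where N: "1 / real (Suc N) < d"
    using nat_approx_posE[OF \<open>0 < d\<close>] by blast
  show "\<exists>N. \<forall>k\<ge>N. norm ((INF q\<in>ball t (1 / real (Suc k)) \<inter> \<rat>. h q) - h t) < e"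
  proof (intro exI[of _ N] allI impI)
    fix k
    assume "N \<le> k"
    then have "1 / real (Suc k) \<le> 1 / real (Suc N)" by (simp add: frac_le)
    then have r: "1 / real (Suc k) < d" using N by simp
    let ?U = "ball t (1 / real (Suc k))"
    have "(INF q\<in>?U \<inter> \<rat>. h q) \<le> h t"
      using cont by (intro INF_rat_le_of_left_continuous bdd)
        (auto simp: isCont_def intro: tendsto_within_subset)
    moreover have "h t - e / 2 \<le> (INF q\<in>?U \<inter> \<rat>. h q)"
    proof (rule cINF_greatest)
      have "t - 1 / real (Suc k) < t" by simp
      then obtain q where "t - 1 / real (Suc k) < q" "q < t" "q \<in> \<rat>"
        using Rats_dense_in_real by blast
      then have "q \<in> ?U \<inter> \<rat>" by (auto simp: dist_real_def)
      then show "?U \<inter> \<rat> \<noteq> {}" by blast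
      show "h t - e / 2 \<le> h q" if "q \<in> ?U \<inter> \<rat>" for q
      proof -
        have "dist q t < d" using that r by (simp add: dist_commute)
        then have "\<bar>h q - h t\<bar> < e / 2" using d[of q] by (simp add: dist_real_def)
        then show ?thesis by linarith
      qed
    qed
    ultimately show "norm ((INF q\<in>?U \<inter> \<rat>. h q) - h t) < e"
      using \<open>0 < e\<close> by (simp add: abs_less_iff)
  qed
qed

section \<open>The loss of an observation as a function of the shift\<close>

lemma compactly_supportedD:
  assumes "compactly_supported g"
  shows "\<exists>A. \<forall>x. A < \<bar>x\<bar> \<longrightarrow> g x = 0"
proof -
  have "bounded {x. g x \<noteq> 0}"
    using assms unfolding compactly_supported_def
    by (rule bounded_subset[OF compact_imp_bounded closure_subset])
  then obtain A where "\<forall>x\<in>{x. g x \<noteq> 0}. norm x \<le> A"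
    unfolding bounded_iff by blast
  then have "g x = 0" if "A < \<bar>x\<bar>" for x using that by fastforce
  then show ?thesis by blast
qed

context template_matching
begin

text \<open>
  An observation is represented by its design point and its noise rather than its design point and its
  response: these two are independent, and the response is a function of them.
\<close>

definition obs :: "nat \<Rightarrow> 'a \<Rightarrow> real \<times> real" where
  "obs i \<omega> = (X i \<omega>, Z i \<omega>)"

definition loss :: "real \<Rightarrow> real \<times> real \<Rightarrow> real" where
  "loss \<theta> p = contrast L f \<theta> (fst p) (f (fst p - \<theta>s) + snd p)"

definition risk :: "real \<Rightarrow> real" where
  "risk \<theta> = expectation (\<lambda>\<omega>. loss \<theta> (obs 0 \<omega>))"

lemma contrast_eq_loss:
  "contrast L f \<theta> (X i \<omega>) (response f \<theta>s X Z i \<omega>) = loss \<theta> (obs i \<omega>)"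
  by (simp add: loss_def obs_def response_def)

lemma population_risk_eq_risk:
  "population_risk P L f (X 0) (response f \<theta>s X Z 0) = risk"
  by (simp add: population_risk_def risk_def contrast_eq_loss fun_eq_iff)

lemma empirical_risk_eq_sum_loss:
  "empirical_risk L f X (response f \<theta>s X Z) n \<omega> \<theta> = (\<Sum>i<n. loss \<theta> (obs i \<omega>)) / real n"
  by (simp add: empirical_risk_def contrast_eq_loss)

lemma X_measurable [measurable]: "X i \<in> borel_measurable P"
  and Z_measurable [measurable]: "Z i \<in> borel_measurable P"
  using design_density[of i] noise_density[of i] unfolding has_density_def
  by (auto dest!: distributed_measurable)

lemma obs_measurable [measurable]: "obs i \<in> P \<rightarrow>\<^sub>M borel \<Otimes>\<^sub>M borel"
  unfolding obs_def by measurable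

lemma distr_X: "distr P borel (X i) = distr P borel (X 0)"
  and distr_Z: "distr P borel (Z i) = distr P borel (Z 0)"
proof -
  have eq: "distr P borel W = density lborel (\<lambda>x. ennreal (d x))" if "has_density P W d" for W d
  proof -
    have "distr P borel W = distr P lborel W" by (rule distr_cong) simp_all
    then show ?thesis using that by (simp add: has_density_def distributed_distr_eq_density)
  qed
  show "distr P borel (X i) = distr P borel (X 0)" "distr P borel (Z i) = distr P borel (Z 0)"
    by (simp_all only: eq[OF design_density] eq[OF noise_density])
qed

lemma iid_function_of_obs:
  assumes "h \<in> borel_measurable (borel \<Otimes>\<^sub>M borel)"
  shows "indep_vars (\<lambda>_. borel) (\<lambda>i \<omega>. h (obs i \<omega>) :: real) UNIV"
    and "distr P borel (\<lambda>\<omega>. h (obs i \<omega>)) = distr P borel (\<lambda>\<omega>. h (obs 0 \<omega>))"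
  unfolding obs_def by (rule iid_function_of_pairs[OF independent distr_X distr_Z assms])+

lemma AE_design:
  assumes [measurable]: "Measurable.pred borel Q" and Q: "AE x in lborel. 0 < lam x \<longrightarrow> Q x"
  shows "AE \<omega> in P. Q (X i \<omega>)"
proof -
  have "distributed P lborel (X i) (\<lambda>x. ennreal (lam x))"
    using design_density[of i] by (simp add: has_density_def)
  from distributed_AE2[OF this, of Q] Q show ?thesis by simp
qed

lemma f_measurable [measurable]: "f \<in> borel_measurable borel"
proof (rule borel_measurable_continuous_countable_exceptions)
  show "countable {x. \<not> isCont f x}" using template_discont by (rule countable_finite)
  show "continuous_on (- {x. \<not> isCont f x}) f"
    by (auto intro!: continuous_at_imp_continuous_on)
qed

lemma isCont_L: "isCont L u"
  using loss_lipschitz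
proof (elim disjE exE conjE)
  fix C assume "lipschitz_on C UNIV L"
  then have "continuous_on UNIV L" by (rule lipschitz_on_continuous_on)
  then show ?thesis by (simp add: continuous_on_eq_continuous_at)
next
  fix L' assume "\<forall>u. (L has_real_derivative L' u) (at u)"
  then show ?thesis using DERIV_isCont by blast
qed

lemma L_measurable [measurable]: "L \<in> borel_measurable borel"
  using isCont_L by (intro borel_measurable_continuous_onI continuous_at_imp_continuous_on) simp

lemma loss_measurable [measurable]: "loss \<theta> \<in> borel_measurable (borel \<Otimes>\<^sub>M borel)"
  unfolding loss_def[abs_def] contrast_def by measurable

lemma loss_integrable: "integrable P (\<lambda>\<omega>. loss \<theta> (obs 0 \<omega>))"
  using risk_finite[of \<theta>] by (simp add: contrast_eq_loss)

lemma loss_ge_0: "0 \<le> loss \<theta> p"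
  by (simp add: loss_def contrast_def loss_nonneg)

lemma loss_bdd_below: "bdd_below ((\<lambda>\<theta>. loss \<theta> p) ` S)"
  by (rule bdd_belowI[of _ 0]) (auto intro: loss_ge_0)

lemma risk_ge_0: "0 \<le> risk \<theta>"
  unfolding risk_def using loss_ge_0 by (rule Bochner_Integration.integral_nonneg)

text \<open>
  Moving the shift \<open>t\<close> up to \<open>\<theta>\<close> from the left moves \<open>x - t\<close> down to \<open>x - \<theta>\<close> from the right, the
  side on which a cadlag template is continuous.
\<close>

lemma loss_tendsto_left: "((\<lambda>t. loss t p) \<longlongrightarrow> loss \<theta> p) (at_left \<theta>)"
proof -
  have "(f \<longlongrightarrow> f (fst p - \<theta>)) (at_right (fst p - \<theta>))"
    using template_cadlag by (simp add: cadlag_def continuous_within)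
  moreover have "filterlim (\<lambda>t. fst p - t) (at_right (fst p - \<theta>)) (at_left \<theta>)"
    unfolding filterlim_at
    by (auto intro!: tendsto_intros simp: eventually_at_filter)
  ultimately have "((\<lambda>t. f (fst p - t)) \<longlongrightarrow> f (fst p - \<theta>)) (at_left \<theta>)"
    by (rule filterlim_compose)
  then show ?thesis
    unfolding loss_def contrast_def
    by (intro isCont_tendsto_compose[OF isCont_L] tendsto_intros)
qed

lemma isCont_loss:
  assumes "isCont f (fst p - \<theta>)"
  shows "isCont (\<lambda>t. loss t p) \<theta>"
proof -
  have "isCont (\<lambda>t. f (fst p - t)) \<theta>"
    by (rule isCont_o2[where g = f]) (use assms in auto)
  then show ?thesis
    unfolding loss_def contrast_def by (intro isCont_o2[OF _ isCont_L] continuous_intros)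
qed

text \<open>
  The rationals make the infimum countable and thereby measurable; by left-continuity
  the result bounds the loss at every parameter of an open set (\<open>local_loss_le\<close>).
\<close>

definition local_loss :: "real set \<Rightarrow> real \<times> real \<Rightarrow> real" where
  "local_loss U p = (INF q\<in>U \<inter> \<rat>. loss q p)"

lemma local_loss_measurable [measurable]:
  "local_loss U \<in> borel_measurable (borel \<Otimes>\<^sub>M borel)"
  unfolding local_loss_def[abs_def]
  by (intro borel_measurable_cINF loss_measurable loss_bdd_below countable_Int2 countable_rat)

lemma local_loss_le:
  assumes "open U" "\<theta> \<in> U"
  shows "local_loss U p \<le> loss \<theta> p"
  unfolding local_loss_def
  using assms by (intro INF_rat_le_of_left_continuous loss_tendsto_left loss_bdd_below)

lemma local_loss_ge_0:
  assumes "open U" "U \<noteq> {}"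
  shows "0 \<le> local_loss U p"
proof -
  obtain t e where "0 < e" "ball t e \<subseteq> U" using assms open_contains_ball by blast
  moreover obtain q where "t - e < q" "q < t" "q \<in> \<rat>"
    using Rats_dense_in_real[of "t - e" t] \<open>0 < e\<close> by auto
  ultimately have "q \<in> U \<inter> \<rat>" by (auto simp: dist_real_def subset_iff)
  then show ?thesis
    unfolding local_loss_def by (intro cINF_greatest loss_ge_0) auto
qed

lemma local_loss_integrable:
  assumes "open U" "U \<noteq> {}"
  shows "integrable P (\<lambda>\<omega>. local_loss U (obs 0 \<omega>))"
proof -
  obtain \<theta> where "\<theta> \<in> U" using assms by blast
  show ?thesis
    by (rule Bochner_Integration.integrable_bound[OF loss_integrable[of \<theta>]])
       (use local_loss_le[OF _ \<open>\<theta> \<in> U\<close>] local_loss_ge_0 loss_ge_0 assms in auto)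
qed

text \<open>
  The loss is continuous in the parameter at \<open>\<theta>\<close> unless \<open>x - \<theta>\<close> is one of the finitely many
  discontinuities of \<open>f\<close>, and a design point with a density avoids these almost surely. The loss at
  the centre of the balls is an integrable majorant of the infima.
\<close>

lemma local_risk_tendsto:
  "(\<lambda>k. expectation (\<lambda>\<omega>. local_loss (ball \<theta> (1 / real (Suc k))) (obs 0 \<omega>))) \<longlonglongrightarrow> risk \<theta>"
  unfolding risk_def
proof (rule integral_dominated_convergence[where w = "\<lambda>\<omega>. loss \<theta> (obs 0 \<omega>)"])
  show "integrable P (\<lambda>\<omega>. loss \<theta> (obs 0 \<omega>))" by (rule loss_integrable)
  define D where "D = (\<lambda>y. y + \<theta>) ` {x. \<not> isCont f x}"
  have "finite D" using template_discont by (simp add: D_def)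
  then have "AE x in lborel. x \<notin> D"
    by (intro AE_not_in finite_imp_null_set_lborel)
  moreover have [measurable]: "D \<in> sets borel"
    using \<open>finite D\<close> by (intro borel_closed finite_imp_closed)
  ultimately have "AE \<omega> in P. X 0 \<omega> \<notin> D"
    by (intro AE_design) auto
  then show "AE \<omega> in P. (\<lambda>k. local_loss (ball \<theta> (1 / real (Suc k))) (obs 0 \<omega>)) \<longlonglongrightarrow> loss \<theta> (obs 0 \<omega>)"
  proof eventually_elim
    case (elim \<omega>)
    then have "isCont f (fst (obs 0 \<omega>) - \<theta>)"
      by (force simp: obs_def D_def image_iff)
    then show ?case
      unfolding local_loss_def by (intro INF_rat_ball_tendsto isCont_loss loss_bdd_below)
  qed
  show "AE \<omega> in P. norm (local_loss (ball \<theta> (1 / real (Suc k))) (obs 0 \<omega>)) \<le> loss \<theta> (obs 0 \<omega>)" for k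
    using local_loss_le[of "ball \<theta> (1 / real (Suc k))" \<theta>]
      local_loss_ge_0[of "ball \<theta> (1 / real (Suc k))"] by simp
qed measurable

lemma ex_ball_local_risk_gt:
  assumes "c < risk \<theta>"
  shows "\<exists>r>0. c < expectation (\<lambda>\<omega>. local_loss (ball \<theta> r) (obs 0 \<omega>))"
proof -
  from order_tendstoD(1)[OF local_risk_tendsto assms]
  obtain k where "c < expectation (\<lambda>\<omega>. local_loss (ball \<theta> (1 / real (Suc k))) (obs 0 \<omega>))"
    by (auto simp: eventually_sequentially)
  then show ?thesis by (intro exI[of _ "1 / real (Suc k)"]) simp
qed

section \<open>Consistency\<close>

lemma risk_gt_away_from_minimizer:
  assumes "0 < \<delta>" "\<delta> \<le> \<bar>\<theta> - \<theta>s\<bar>"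
  shows "risk \<theta>s < risk \<theta>"
proof -
  have "risk \<theta>s < (INF \<theta>\<in>{\<theta>. \<delta> \<le> \<bar>\<theta> - \<theta>s\<bar>}. risk \<theta>)"
    using risk_separated[OF assms(1)] by (simp only: population_risk_eq_risk)
  also have "\<dots> \<le> risk \<theta>"
    using assms(2) risk_ge_0 by (intro cINF_lower bdd_belowI[of _ 0]) auto
  finally show ?thesis .
qed

text \<open>
  If \<open>f\<close> vanishes outside \<open>[-A, A]\<close> and the design points lie in \<open>[-B, B]\<close>, a shift by more than
  \<open>A + B\<close> moves the template off all design points. The null set where this fails
  does not depend on the parameters.
\<close>

lemma loss_constant_far_away:
  "\<exists>K. AE \<omega> in P. \<forall>i \<theta> \<theta>'. K < \<bar>\<theta>\<bar> \<longrightarrow> K < \<bar>\<theta>'\<bar> \<longrightarrow> loss \<theta> (obs i \<omega>) = loss \<theta>' (obs i \<omega>)"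
proof -
  obtain A where A: "\<And>x. A < \<bar>x\<bar> \<Longrightarrow> f x = 0"
    using compactly_supportedD[OF template_support] by blast
  obtain B where B: "\<And>x. B < \<bar>x\<bar> \<Longrightarrow> lam x = 0"
    using compactly_supportedD[OF design_support] by blast
  have "AE \<omega> in P. \<bar>X i \<omega>\<bar> \<le> B" for i
  proof (rule AE_design)
    have "\<bar>x\<bar> \<le> B" if "0 < lam x" for x
      using B[of x] that by (cases "B < \<bar>x\<bar>") auto
    then show "AE x in lborel. 0 < lam x \<longrightarrow> \<bar>x\<bar> \<le> B" by simp
  qed simp
  then have "AE \<omega> in P. \<forall>i. \<bar>X i \<omega>\<bar> \<le> B" by (simp add: AE_all_countable)
  then have "AE \<omega> in P. \<forall>i \<theta> \<theta>'. A + B < \<bar>\<theta>\<bar> \<longrightarrow> A + B < \<bar>\<theta>'\<bar> \<longrightarrow>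
      loss \<theta> (obs i \<omega>) = loss \<theta>' (obs i \<omega>)"
  proof eventually_elim
    case (elim \<omega>)
    have "f (X i \<omega> - \<theta>) = 0" if "A + B < \<bar>\<theta>\<bar>" for i \<theta>
    proof (rule A)
      show "A < \<bar>X i \<omega> - \<theta>\<bar>"
        using that spec[OF elim, of i] by linarith
    qed
    then show ?case by (simp add: loss_def contrast_def obs_def)
  qed
  then show ?thesis by blast
qed

text \<open>
  The compact part of the parameter set is covered by finitely many balls with large expected
  infimum, the rest is represented by a single distant parameter. The same bracket serves all
  observations simultaneously, so the inequality can be summed over a sample; and the
  null set is common to all \<open>\<theta>\<close>, so the inequality may be applied at a random parameter.
\<close>

lemma finite_lower_bracket:
  assumes "0 < \<delta>"
  shows "\<exists>G. finite G \<and>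
    (\<forall>g\<in>G. g \<in> borel_measurable (borel \<Otimes>\<^sub>M borel) \<and> integrable P (\<lambda>\<omega>. g (obs 0 \<omega>)) \<and>
       risk \<theta>s < expectation (\<lambda>\<omega>. g (obs 0 \<omega>))) \<and>
    (AE \<omega> in P. \<forall>\<theta>. \<delta> \<le> \<bar>\<theta> - \<theta>s\<bar> \<longrightarrow> (\<exists>g\<in>G. \<forall>i. g (obs i \<omega>) \<le> loss \<theta> (obs i \<omega>)))"
proof -
  obtain K where K: "AE \<omega> in P. \<forall>i \<theta> \<theta>'. K < \<bar>\<theta>\<bar> \<longrightarrow> K < \<bar>\<theta>'\<bar> \<longrightarrow>
      loss \<theta> (obs i \<omega>) = loss \<theta>' (obs i \<omega>)"
    using loss_constant_far_away by blast
  \<comment> \<open>A parameter in the range of constant loss that is also at distance at least \<open>\<delta>\<close> from \<open>\<theta>s\<close>.\<close>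
  define far where "far = \<bar>K\<bar> + \<bar>\<theta>s\<bar> + \<delta> + 1"
  have far: "K < \<bar>far\<bar>" "\<delta> \<le> \<bar>far - \<theta>s\<bar>"
    using assms unfolding far_def by linarith+
  define S where "S = {\<theta>. \<delta> \<le> \<bar>\<theta> - \<theta>s\<bar>} \<inter> {- K..K}"
  have "closed {\<theta>. \<delta> \<le> \<bar>\<theta> - \<theta>s\<bar>}" by (intro closed_Collect_le continuous_intros)
  then have "compact S" unfolding S_def by (intro closed_Int_compact compact_Icc)
  have "\<forall>\<theta>\<in>S. \<exists>r>0. risk \<theta>s < expectation (\<lambda>\<omega>. local_loss (ball \<theta> r) (obs 0 \<omega>))"
    using risk_gt_away_from_minimizer[OF assms] ex_ball_local_risk_gt by (auto simp: S_def)
  then obtain r where "\<forall>\<theta>\<in>S. 0 < r \<theta> \<and>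
      risk \<theta>s < expectation (\<lambda>\<omega>. local_loss (ball \<theta> (r \<theta>)) (obs 0 \<omega>))"
    by (auto dest!: bchoice)
  then have r: "\<And>\<theta>. \<theta> \<in> S \<Longrightarrow> 0 < r \<theta>"
    "\<And>\<theta>. \<theta> \<in> S \<Longrightarrow> risk \<theta>s < expectation (\<lambda>\<omega>. local_loss (ball \<theta> (r \<theta>)) (obs 0 \<omega>))"
    by auto
  obtain C where C: "C \<subseteq> S" "finite C" "S \<subseteq> (\<Union>\<theta>\<in>C. ball \<theta> (r \<theta>))"
    proof (rule compactE_image[OF \<open>compact S\<close>, of S "\<lambda>\<theta>. ball \<theta> (r \<theta>)"])
    show "S \<subseteq> (\<Union>\<theta>\<in>S. ball \<theta> (r \<theta>))" using r(1) by force
  qed auto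
  define G where "G = insert (loss far) ((\<lambda>\<theta>. local_loss (ball \<theta> (r \<theta>))) ` C)"
  have "g \<in> borel_measurable (borel \<Otimes>\<^sub>M borel) \<and> integrable P (\<lambda>\<omega>. g (obs 0 \<omega>)) \<and>
       risk \<theta>s < expectation (\<lambda>\<omega>. g (obs 0 \<omega>))" if "g \<in> G" for g
    using that unfolding G_def
  proof (elim insertE imageE)
    assume "g = loss far"
    then show ?thesis
      using risk_gt_away_from_minimizer[OF assms far(2)] loss_integrable by (simp add: risk_def)
  next
    fix \<theta> assume "g = local_loss (ball \<theta> (r \<theta>))" "\<theta> \<in> C"
    then have "\<theta> \<in> S" using C(1) by blast
    from r(1)[OF this] have "ball \<theta> (r \<theta>) \<noteq> {}" by simp
    with \<open>\<theta> \<in> S\<close> show ?thesis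
      unfolding \<open>g = _\<close> by (intro conjI r(2) local_loss_integrable local_loss_measurable open_ball)
  qed
  moreover have "AE \<omega> in P. \<forall>\<theta>. \<delta> \<le> \<bar>\<theta> - \<theta>s\<bar> \<longrightarrow> (\<exists>g\<in>G. \<forall>i. g (obs i \<omega>) \<le> loss \<theta> (obs i \<omega>))"
    using K
  proof eventually_elim
    case (elim \<omega>)
    show ?case
    proof (intro allI impI)
      fix \<theta> assume \<theta>: "\<delta> \<le> \<bar>\<theta> - \<theta>s\<bar>"
      show "\<exists>g\<in>G. \<forall>i. g (obs i \<omega>) \<le> loss \<theta> (obs i \<omega>)"
      proof (cases "K < \<bar>\<theta>\<bar>")
        case True
        then have "loss far (obs i \<omega>) \<le> loss \<theta> (obs i \<omega>)" for i
          using elim far(1) by (simp add: order_eq_iff)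
        then show ?thesis by (auto simp: G_def)
      next
        case False
        then have "\<theta> \<in> S" using \<theta> by (auto simp: S_def)
        then obtain \<theta>' where "\<theta>' \<in> C" "\<theta> \<in> ball \<theta>' (r \<theta>')" using C(3) by blast
        from \<open>\<theta>' \<in> C\<close> have "local_loss (ball \<theta>' (r \<theta>')) \<in> G" by (simp add: G_def)
        moreover have "\<forall>i. local_loss (ball \<theta>' (r \<theta>')) (obs i \<omega>) \<le> loss \<theta> (obs i \<omega>)"
          using \<open>\<theta> \<in> ball \<theta>' (r \<theta>')\<close> by (intro allI local_loss_le open_ball)
        ultimately show ?thesis by blast
      qed
    qed
  qed
  moreover have "finite G" using C(2) by (simp add: G_def)
  ultimately show ?thesis by blast
qed

text \<open>
  A minimizer far from \<open>\<theta>s\<close> forces some bracket function to have an empirical mean no larger than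
  that of the loss at \<open>\<theta>s\<close>; each of these finitely many events has vanishing probability.
\<close>

theorem argmin_consistent:
  assumes argmin: "\<And>n. 1 \<le> n \<Longrightarrow>
      AE \<omega> in P. is_arg_min (empirical_risk L f X (response f \<theta>s X Z) n \<omega>) (\<lambda>_. True) (\<theta>hat n \<omega>)"
  shows "converges_in_prob P \<theta>hat \<theta>s"
  unfolding converges_in_prob_def
proof (intro allI impI)
  fix \<delta> :: real
  assume "0 < \<delta>"
  obtain G where "finite G"
    and G: "\<And>g. g \<in> G \<Longrightarrow> g \<in> borel_measurable (borel \<Otimes>\<^sub>M borel)"
      "\<And>g. g \<in> G \<Longrightarrow> integrable P (\<lambda>\<omega>. g (obs 0 \<omega>))"
      "\<And>g. g \<in> G \<Longrightarrow> risk \<theta>s < expectation (\<lambda>\<omega>. g (obs 0 \<omega>))"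
    and bracket: "AE \<omega> in P. \<forall>\<theta>. \<delta> \<le> \<bar>\<theta> - \<theta>s\<bar> \<longrightarrow>
      (\<exists>g\<in>G. \<forall>i. g (obs i \<omega>) \<le> loss \<theta> (obs i \<omega>))"
    using finite_lower_bracket[OF \<open>0 < \<delta>\<close>] by blast
  define bad where "bad g n = {\<omega> \<in> space P. (\<Sum>i<n. g (obs i \<omega>) - loss \<theta>s (obs i \<omega>)) \<le> 0}" for g n
  have bad_sets: "bad g n \<in> sets P" if "g \<in> G" for g n
  proof -
    note [measurable] = G(1)[OF that]
    show ?thesis unfolding bad_def by measurable
  qed
  have bad: "(\<lambda>n. prob (bad g n)) \<longlonglongrightarrow> 0" if "g \<in> G" for g
    unfolding bad_def
  proof (rule prob_sum_nonpos_tendsto_0)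
    note [measurable] = G(1)[OF that]
    have h: "(\<lambda>p. g p - loss \<theta>s p) \<in> borel_measurable (borel \<Otimes>\<^sub>M borel)" by measurable
    show "indep_vars (\<lambda>_. borel) (\<lambda>i \<omega>. g (obs i \<omega>) - loss \<theta>s (obs i \<omega>)) UNIV"
      "distr P borel (\<lambda>\<omega>. g (obs i \<omega>) - loss \<theta>s (obs i \<omega>))
        = distr P borel (\<lambda>\<omega>. g (obs 0 \<omega>) - loss \<theta>s (obs 0 \<omega>))" for i
      by (rule iid_function_of_obs[OF h])+
    show "integrable P (\<lambda>\<omega>. g (obs 0 \<omega>) - loss \<theta>s (obs 0 \<omega>))"
      "0 < expectation (\<lambda>\<omega>. g (obs 0 \<omega>) - loss \<theta>s (obs 0 \<omega>))"
      using G(2,3)[OF that] loss_integrable[of \<theta>s] by (simp_all add: risk_def)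
  qed
  have le: "prob {\<omega> \<in> space P. \<delta> < \<bar>\<theta>hat n \<omega> - \<theta>s\<bar>} \<le> (\<Sum>g\<in>G. prob (bad g n))" if "1 \<le> n" for n
  proof -
    have "AE \<omega> in P. \<omega> \<in> {\<omega> \<in> space P. \<delta> < \<bar>\<theta>hat n \<omega> - \<theta>s\<bar>} \<longrightarrow> \<omega> \<in> (\<Union>g\<in>G. bad g n)"
      using bracket argmin[OF that]
    proof eventually_elim
      case (elim \<omega>)
      show ?case
      proof
        assume \<omega>: "\<omega> \<in> {\<omega> \<in> space P. \<delta> < \<bar>\<theta>hat n \<omega> - \<theta>s\<bar>}"
        then obtain g where "g \<in> G" and g: "\<And>i. g (obs i \<omega>) \<le> loss (\<theta>hat n \<omega>) (obs i \<omega>)"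
          using elim(1) by (auto dest: less_imp_le)
        have "(\<Sum>i<n. g (obs i \<omega>)) \<le> (\<Sum>i<n. loss (\<theta>hat n \<omega>) (obs i \<omega>))"
          using g by (rule sum_mono)
        also have "\<dots> \<le> (\<Sum>i<n. loss \<theta>s (obs i \<omega>))"
          using elim(2) that
          by (simp add: is_arg_min_linorder empirical_risk_eq_sum_loss divide_le_cancel)
        finally show "\<omega> \<in> (\<Union>g\<in>G. bad g n)"
          using \<open>g \<in> G\<close> \<omega> by (auto simp: bad_def sum_subtractf)
      qed
    qed
    then have "prob {\<omega> \<in> space P. \<delta> < \<bar>\<theta>hat n \<omega> - \<theta>s\<bar>} \<le> prob (\<Union>g\<in>G. bad g n)"
      by (rule finite_measure_mono_AE) (use \<open>finite G\<close> bad_sets in auto)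
    also have "\<dots> \<le> (\<Sum>g\<in>G. prob (bad g n))"
      using \<open>finite G\<close> bad_sets by (intro finite_measure_subadditive_finite) auto
    finally show ?thesis .
  qed
  have "(\<lambda>n. \<Sum>g\<in>G. prob (bad g n)) \<longlonglongrightarrow> (\<Sum>g\<in>G. 0)"
    using bad by (rule tendsto_sum)
  then have lim: "(\<lambda>n. \<Sum>g\<in>G. prob (bad g n)) \<longlonglongrightarrow> 0" by simp
  show "(\<lambda>n. prob {\<omega> \<in> space P. \<delta> < \<bar>\<theta>hat n \<omega> - \<theta>s\<bar>}) \<longlonglongrightarrow> 0"
    by (rule tendsto_sandwich[OF _ _ tendsto_const lim])
       (auto intro!: eventually_sequentiallyI[of 1] le)
qed

end

theorem theorem2p1:
  fixes P :: "'a measure"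
    and f lam \<phi> L :: "real \<Rightarrow> real"
    and \<theta>s :: real
    and X Z :: "nat \<Rightarrow> 'a \<Rightarrow> real"
    and \<theta>hat :: "nat \<Rightarrow> 'a \<Rightarrow> real"
  assumes "template_matching P f lam \<phi> L \<theta>s X Z"
    and "\<And>n. 1 \<le> n \<Longrightarrow> \<theta>hat n \<in> borel_measurable P"
    and "\<And>n. 1 \<le> n \<Longrightarrow>
           AE \<omega> in P. is_arg_min (empirical_risk L f X (response f \<theta>s X Z) n \<omega>) (\<lambda>_. True) (\<theta>hat n \<omega>)"
  shows "converges_in_prob P \<theta>hat \<theta>s"
  by (rule template_matching.argmin_consistent[OF assms(1,3)])

end
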